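(* Let $n\geq 1$ be an integer, let $a_1,a_2,\dots,a_n\geq 0$ be real numbers, and let $\bar a=\sum_{i=1}^n a_i$. Then the function $$f(z)=\frac{\Gamma(z+1)^{\,n-1}\,\Gamma(z-\bar a+1)}{\prod_{i=1}^n\Gamma(z-a_i+1)},\qquad z>\bar a-1,$$ is completely monotonic on the interval $(\bar a-1,\infty)$.
   Context: $\Gamma(x)=\int_0^\infty e^{-t}t^{x-1}\,dt$ for $x>0$ is the gamma function. A real function $f$ is called completely monotonic on an interval $I\subset\mathbb{R}$ if it has derivatives $f^{(k)}$ of every order $k=0,1,2,\dots$ on $I$ and $(-1)^k f^{(k)}(z)\geq 0$ for all $z\in I$ and all $k\geq 0$. *)

theory Defs
  imports "HOL-Analysis.Analysis"
begin

text \<open>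
  The witness \<open>D k\<close> is the k-th derivative of \<open>f\<close> on \<open>I\<close>.
  Derivatives are taken within \<open>I\<close>, hence one-sided at endpoints that belong to \<open>I\<close>,
  and do not depend on values outside \<open>I\<close>. On an interval with more than one point the values of
  each \<open>D k\<close> on \<open>I\<close> are uniquely determined by \<open>f\<close>.
\<close>

definition completely_monotonic_on :: "real set \<Rightarrow> (real \<Rightarrow> real) \<Rightarrow> bool" where
  "completely_monotonic_on I f \<longleftrightarrow>
     (\<exists>D :: nat \<Rightarrow> real \<Rightarrow> real.
        (\<forall>z\<in>I. D 0 z = f z) \<and>
        (\<forall>k. \<forall>z\<in>I. (D k has_real_derivative D (Suc k) z) (at z within I)) \<and>
        (\<forall>k. \<forall>z\<in>I. (-1) ^ k * D k z \<ge> 0))"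

end

theory Submission
  imports Defs
begin

text \<open>
  With \<open>\<psi> = Polygamma 0\<close>, \<open>- (ln f)'\<close> is
  \<open>h z = (\<Sum>i. \<psi> (z - a i + 1) - \<psi> (z + 1)) - (\<psi> (z - abar + 1) - \<psi> (z + 1))\<close>.
  Since \<open>(-1) ^ k * Polygamma k\<close> is concave on the positive axis, its increments from
  \<open>z + 1\<close> are subadditive in the shift, so \<open>h\<close> is completely monotonic. As \<open>f' = - h * f\<close>,
  each derivative of \<open>f\<close> is, up to the sign \<open>(-1) ^ k\<close>, a sum of products of \<open>f\<close> with factors
  that are signed derivatives of \<open>h\<close>, all of which are nonnegative.
\<close>

text \<open>No closed form for the derivatives is needed: choosing \<open>w\<close> from
  \<open>v\<close> repeatedly gives a sequence \<open>F\<close> inside \<open>S\<close> with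
  \<open>F k\<close> equal to \<open>(-1) ^ k\<close> times the k-th derivative of \<open>u\<close>,
  and membership in \<open>S\<close> settles every sign.\<close>

lemma completely_monotonic_on_coinduct:
  assumes "u \<in> S"
    and nonneg: "\<And>v z. v \<in> S \<Longrightarrow> z \<in> I \<Longrightarrow> v z \<ge> 0"
    and deriv: "\<And>v. v \<in> S \<Longrightarrow>
      \<exists>w\<in>S. \<forall>z\<in>I. (v has_real_derivative - w z) (at z within I)"
  shows "completely_monotonic_on I u"
proof -
  have "\<exists>F. \<forall>k. F k \<in> S \<and> (k = 0 \<longrightarrow> F k = u) \<and>
      (\<forall>z\<in>I. (F k has_real_derivative - F (Suc k) z) (at z within I))"
    using dependent_nat_choice
      [where P = "\<lambda>k v. v \<in> S \<and> (k = 0 \<longrightarrow> v = u)" and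
        Q = "\<lambda>k v w. \<forall>z\<in>I. (v has_real_derivative - w z) (at z within I)"]
      assms(1) deriv by (metis (no_types, lifting) nat.distinct(1))
  then obtain F where F: "\<And>k. F k \<in> S" "F 0 = u"
      "\<And>k z. z \<in> I \<Longrightarrow> (F k has_real_derivative - F (Suc k) z) (at z within I)"
    by blast
  have "((\<lambda>z. (-1) ^ k * F k z) has_real_derivative (-1) ^ Suc k * F (Suc k) z) (at z within I)"
    if "z \<in> I" for k z
    using DERIV_cmult[OF F(3)[OF that], of "(-1) ^ k"] by simp
  moreover have "(-1) ^ k * ((-1) ^ k * F k z) \<ge> 0" if "z \<in> I" for k z
    using nonneg[OF F(1) that, of k] by (simp flip: mult.assoc power_add)
  ultimately show ?thesis
    unfolding completely_monotonic_on_def using F(2)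
    by (intro exI[of _ "\<lambda>k z. (-1) ^ k * F k z"]) auto
qed

text \<open>Serves as the invariant \<open>S\<close> for \<open>f' = - H 0 * f\<close>, with
  \<open>H j\<close> the j-th derivative of \<open>H 0\<close>: \<open>mult\<close> admits only
  sign-corrected factors, and \<open>add\<close> absorbs the sums produced by the product
  rule.\<close>

inductive_set signed_products :: "(real \<Rightarrow> real) \<Rightarrow> (nat \<Rightarrow> real \<Rightarrow> real) \<Rightarrow> (real \<Rightarrow> real) set"
  for f H where
  base: "f \<in> signed_products f H"
| add: "u \<in> signed_products f H \<Longrightarrow> v \<in> signed_products f H \<Longrightarrow>
    (\<lambda>z. u z + v z) \<in> signed_products f H"
| mult: "u \<in> signed_products f H \<Longrightarrow> (\<lambda>z. (-1) ^ j * H j z * u z) \<in> signed_products f H"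

lemma completely_monotonic_on_exp:
  assumes L: "\<And>z. z \<in> I \<Longrightarrow> (L has_real_derivative - H 0 z) (at z within I)"
    and H: "\<And>k z. z \<in> I \<Longrightarrow> (H k has_real_derivative H (Suc k) z) (at z within I)"
    and sign: "\<And>k z. z \<in> I \<Longrightarrow> (-1) ^ k * H k z \<ge> 0"
  shows "completely_monotonic_on I (\<lambda>z. exp (L z))"
proof (rule completely_monotonic_on_coinduct)
  let ?S = "signed_products (\<lambda>z. exp (L z)) H"
  show "(\<lambda>z. exp (L z)) \<in> ?S"
    by (rule signed_products.base)
  show "v z \<ge> 0" if "v \<in> ?S" "z \<in> I" for v z
    using that(1) by induction (auto intro: mult_nonneg_nonneg sign[OF that(2)])
  show "\<exists>w\<in>?S. \<forall>z\<in>I. (v has_real_derivative - w z) (at z within I)" if "v \<in> ?S" for v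
    using that
  proof induction
    case base
    have "(\<lambda>z. (-1) ^ 0 * H 0 z * exp (L z)) \<in> ?S"
      by (intro signed_products.intros)
    then show ?case
      by (rule bexI[rotated]) (auto intro!: derivative_eq_intros L)
  next
    case (add u v)
    then obtain u' v' where "u' \<in> ?S" "v' \<in> ?S"
      and d: "\<And>z. z \<in> I \<Longrightarrow> (u has_real_derivative - u' z) (at z within I)"
        "\<And>z. z \<in> I \<Longrightarrow> (v has_real_derivative - v' z) (at z within I)"
      by blast
    then have "(\<lambda>z. u' z + v' z) \<in> ?S"
      by (intro signed_products.intros)
    then show ?case
      by (rule bexI[rotated]) (auto intro!: derivative_eq_intros d)
  next
    case (mult u j)
    then obtain u' where "u' \<in> ?S"
      and d: "\<And>z. z \<in> I \<Longrightarrow> (u has_real_derivative - u' z) (at z within I)"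
      by blast
    with mult.hyps
    \<comment> \<open>Negating the product rule turns \<open>(-1) ^ j * H (Suc j)\<close> into the
      admissible factor of index \<open>Suc j\<close>; in the second term the minus sign is already
      part of the derivative \<open>- u'\<close>.\<close>
    have "(\<lambda>z. (-1) ^ Suc j * H (Suc j) z * u z + (-1) ^ j * H j z * u' z) \<in> ?S"
      by (intro signed_products.intros)
    then show ?case
      by (rule bexI[rotated]) (auto intro!: derivative_eq_intros d H simp: algebra_simps)
  qed
qed

lemma Polygamma_signed_mono:
  fixes x y :: real
  assumes "0 < x" "x \<le> y"
  shows "(-1) ^ k * Polygamma k x \<le> (-1) ^ k * Polygamma k y"
  using assms Polygamma_real_mono[of x y k] Polygamma_real_strict_antimono[of x y k]
  by (cases "even k"; cases "x = y") auto

text \<open>The derivative of \<open>(-1) ^ k * Polygamma k\<close> is minus the signed function of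
  order \<open>Suc k\<close>, which is increasing. Hence increments over a step \<open>b\<close>
  shrink as the base point moves right.\<close>

lemma Polygamma_signed_concave:
  fixes x a b :: real
  assumes "x > 0" "a \<ge> 0" "b \<ge> 0"
  shows "(-1) ^ k * Polygamma k x + (-1) ^ k * Polygamma k (x + a + b)
    \<le> (-1) ^ k * Polygamma k (x + a) + (-1) ^ k * Polygamma k (x + b)"
proof -
  let ?g = "\<lambda>t. (-1) ^ k * Polygamma k (t + b) - (-1) ^ k * Polygamma k t"
  have "?g (x + a) \<le> ?g x"
  proof (rule DERIV_nonpos_imp_nonincreasing[of x "x + a"])
    fix t assume "x \<le> t"
    with assms have t: "t > 0"
      by simp
    then have "t \<notin> \<int>\<^sub>\<le>\<^sub>0" "t + b \<notin> \<int>\<^sub>\<le>\<^sub>0"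
      using assms by (auto elim!: nonpos_Ints_cases)
    then have "(?g has_real_derivative
        (-1) ^ k * Polygamma (Suc k) (t + b) - (-1) ^ k * Polygamma (Suc k) t) (at t)"
      by (auto intro!: derivative_eq_intros)
    moreover have "(-1) ^ k * Polygamma (Suc k) (t + b) - (-1) ^ k * Polygamma (Suc k) t \<le> 0"
      using Polygamma_signed_mono[OF t, of "t + b" "Suc k"] assms by simp
    ultimately show "\<exists>d. (?g has_real_derivative d) (at t) \<and> d \<le> 0"
      by blast
  qed (use assms in simp)
  then show ?thesis
    by (simp add: add_ac)
qed

lemma Polygamma_signed_increment_subadditive:
  fixes a :: "'i \<Rightarrow> real" and y :: real
  assumes "finite A" "\<And>i. i \<in> A \<Longrightarrow> a i \<ge> 0" "sum a A < y"
  shows "(-1) ^ k * (Polygamma k (y - sum a A) - Polygamma k y)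
    \<le> (-1) ^ k * (\<Sum>i\<in>A. Polygamma k (y - a i) - Polygamma k y)"
  using assms
proof (induction A rule: finite_induct)
  case (insert i A)
  then have "a i \<ge> 0" "sum a A \<ge> 0"
    by (auto intro: sum_nonneg)
  moreover from this insert.hyps insert.prems(2) have "sum a A < y"
    by simp
  ultimately show ?case
    \<comment> \<open>The four points are \<open>y\<close> minus the full sum,
      \<open>y - sum a A\<close>, \<open>y - a i\<close> and \<open>y\<close>; the full sum being
      below \<open>y\<close> makes the lowest one positive.\<close>
    using insert Polygamma_signed_concave[of "y - sum a A - a i" "a i" "sum a A" k]
    by (simp add: algebra_simps)
qed simp

theorem theorem2p3:
  fixes n :: nat and a :: "nat \<Rightarrow> real" and abar :: real
  assumes "n \<ge> 1"
    and "\<And>i. i \<in> {1..n} \<Longrightarrow> a i \<ge> 0"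
    and "abar = (\<Sum>i=1..n. a i)"
  shows "completely_monotonic_on {abar - 1 <..}
           (\<lambda>z. Gamma (z + 1) ^ (n - 1) * Gamma (z - abar + 1) /
                (\<Prod>i=1..n. Gamma (z - a i + 1)))"
proof -
  let ?I = "{abar - 1 <..}"
  let ?f = "\<lambda>z. Gamma (z + 1) ^ (n - 1) * Gamma (z - abar + 1) /
    (\<Prod>i=1..n. Gamma (z - a i + 1))"
  define L where "L = (\<lambda>z. real (n - 1) * ln_Gamma (z + 1) + ln_Gamma (z - abar + 1)
    - (\<Sum>i=1..n. ln_Gamma (z - a i + 1)))"
  \<comment> \<open>\<open>Polygamma k (z + 1)\<close> is subtracted \<open>n\<close> times and
    added back once, matching the exponent \<open>n - 1\<close>; here \<open>n \<ge> 1\<close> makes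
    \<open>real (n - 1) = real n - 1\<close>.\<close>
  define H where "H = (\<lambda>k z. (\<Sum>i=1..n. Polygamma k (z - a i + 1) - Polygamma k (z + 1))
    - (Polygamma k (z - abar + 1) - Polygamma k (z + 1)))"
  have "a i \<le> abar" if "i \<in> {1..n}" for i
    unfolding assms(3) using assms(2) that by (intro member_le_sum) auto
  moreover have "abar \<ge> 0"
    unfolding assms(3) using assms(2) by (intro sum_nonneg)
  ultimately have pos: "z + 1 > 0" "z - abar + 1 > 0" "\<And>i. i \<in> {1..n} \<Longrightarrow> z - a i + 1 > 0"
    if "z \<in> ?I" for z
    using that by (simp, simp, fastforce)
  have f_eq: "?f z = exp (L z)" if "z \<in> ?I" for z
  proof -
    have "exp (real (n - 1) * ln_Gamma (z + 1)) = Gamma (z + 1) ^ (n - 1)"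
      using pos(1)[OF that] by (simp add: exp_of_nat_mult Gamma_real_pos_exp)
    moreover have "exp (\<Sum>i=1..n. ln_Gamma (z - a i + 1)) = (\<Prod>i=1..n. Gamma (z - a i + 1))"
      unfolding exp_sum[OF finite_atLeastAtMost]
      using pos(3)[OF that] by (intro prod.cong) (simp_all add: Gamma_real_pos_exp)
    ultimately show ?thesis
      using pos(2)[OF that] by (simp add: L_def exp_diff exp_add Gamma_real_pos_exp)
  qed
  have "completely_monotonic_on ?I (\<lambda>z. exp (L z))"
  proof (rule completely_monotonic_on_exp)
    fix z assume z: "z \<in> ?I"
    have "(L has_real_derivative real (n - 1) * Digamma (z + 1) + Digamma (z - abar + 1)
        - (\<Sum>i=1..n. Digamma (z - a i + 1))) (at z within ?I)"
      unfolding L_def using pos[OF z] by (auto intro!: derivative_eq_intros)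
    also have "real (n - 1) * Digamma (z + 1) + Digamma (z - abar + 1)
        - (\<Sum>i=1..n. Digamma (z - a i + 1)) = - H 0 z"
      using assms(1) by (simp add: H_def sum_subtractf of_nat_diff algebra_simps)
    finally show "(L has_real_derivative - H 0 z) (at z within ?I)" .
  next
    fix k z assume z: "z \<in> ?I"
    have *: "t \<notin> \<int>\<^sub>\<le>\<^sub>0" if "t > 0" for t :: real
      using that by (auto elim!: nonpos_Ints_cases)
    show "(H k has_real_derivative H (Suc k) z) (at z within ?I)"
      unfolding H_def using pos[OF z, THEN *] by (auto intro!: derivative_eq_intros)
    show "(-1) ^ k * H k z \<ge> 0"
      \<comment> \<open>With \<open>y = z + 1\<close>, the condition \<open>sum a A < y\<close> is
        exactly \<open>z > abar - 1\<close>.\<close>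
      using Polygamma_signed_increment_subadditive[of "{1..n}" a "z + 1" k] assms(2) pos(2)[OF z]
      by (simp add: H_def assms(3) algebra_simps)
  qed
  then show ?thesis
    \<comment> \<open>The function enters the definition only through its values on the interval, so
      \<open>f_eq\<close> transfers the witness unchanged.\<close>
    unfolding completely_monotonic_on_def using f_eq by simp
qed

end
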